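(* There exists a $4\times 4$ limited augmented bipartite graph $G=(S,T,E_1\cup E_2)$ satisfying (S), (W1), (W2) and (W2'), but violating (W3), whose associated doubly simple biquadratic form satisfies $$\mathrm{SOS}(P_G)\le 10<11=|E_1|+|E_2|.$$ Hence this example is reducible (not irreducible). In particular, (W3) cannot be removed entirely from the weak framework: it is not true that every augmented bipartite graph satisfying (S), (W1), (W2) and (W2') has an irreducible associated form.
   Context: Notation: $[m]=\{1,\dots,m\}$. For an $m\times n$ biquadratic form $P(\mathbf{x},\mathbf{y})$ that is a finite sum of squares of real bilinear forms in $(\mathbf{x},\mathbf{y})$, $\mathrm{SOS}(P)$ (the SOS rank, also written $\operatorname{sos}(P)$) is the minimum number of squares in such a representation. $z(m,n)$ (the Zarankiewicz number) is the maximum number of edges of an $m\times n$ bipartite graph with no $C_4$. Augmented bipartite graphs $G=(S,T,E_1\cup E_2)$, $S=[m]$, $T=[n]$. A cell is a pair $(i,j)\in[m]\times[n]$ ($i$ is its row, $j$ its column). A 1-edge is a cell; $E_1$ is a set of 1-edges, viewed as a bipartite graph $G_1$ on $S,T$. A 2-edge is an unordered pair of distinct cells, written $(i,j;k,l)$; the cells $(i,j)$ and $(k,l)$ are its two halves. It is nondegenerate if $i\ne k$ and $j\ne l$, row-degenerate if $i=k$ and $j\neq l$, column-degenerate if $i\ne k$ and $j=l$. $E_2$ is a set of 2-edges. $G$ is called limited if $|E_1|=z(m,n)$. The associated doubly simple biquadratic form is $P_G=\sum_{(i,j)\in E_1}x_i^2y_j^2+\sum_{(i,j;k,l)\in E_2}(x_iy_j+x_ky_l)^2$;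 it is called irreducible if $\mathrm{SOS}(P_G)=|E_1|+|E_2|$. A cell is occupied if it is in $E_1$ or is a half of some 2-edge in $E_2$; otherwise it is unoccupied. The opposite cells of a nondegenerate 2-edge $(i,j;k,l)$ are $(i,l)$ and $(k,j)$. Two nondegenerate 2-edges of the form $(i,j;k,l)$ and $(i,l;k,j)$ are called complementary. The dependency graph $\mathcal{D}$ is the directed graph whose vertices are the nondegenerate 2-edges in $E_2$, with an arc $e\to e'$ ($e\ne e'$) if both opposite cells of $e$ are occupied and one half of $e'$ is an opposite cell of $e$. An edge's row (column) set is the set of rows (columns) of its cell (1-edge) or of its halves (2-edge). Two edges are vertex-disjoint if their row sets are disjoint and their column sets are disjoint. The opposite cells of a vertex-disjoint pair $e,f$ are the cells formed by a row of one of the two edges and a column of the other. For a 1-edge $(i,j)$ and a 2-edge $(k,l;p,q)$ they are $(i,l),(i,q),(k,j),(p,j)$. Conditions: (S) No 2-edge shares a cell with any 1-edge or with any other 2-edge. (W1) $G_1$ contains no $C_4$. (W2) $\mathcal{D}$ contains no directed cycle other than 2-cycles formed by a pair of complementary 2-edges (which are allowed). (W2') There is no nondegenerate 2-edge in $E_2$ whose two opposite cells are both 1-edges. (W3) For every vertex-disjoint pair of edges of $G$ at least one of which is a 2-edge, at least one of the opposite cells of the pair is unoccupied. *)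

theory Defs
  imports Complex_Main "Graph_Theory.Arc_Walk"
begin

type_synonym cell = "nat \<times> nat"

definition cells :: "nat \<Rightarrow> nat \<Rightarrow> cell set" where
  "cells m n = {1..m} \<times> {1..n}"

section \<open>Sums of squares of bilinear forms\<close>

text \<open>
  Forms in \<open>x\<^sub>1, \<dots>, x\<^sub>m\<close> and \<open>y\<^sub>1, \<dots>, y\<^sub>n\<close> are represented by the real functions they induce
  on sequences \<open>x, y :: nat \<Rightarrow> real\<close>, which depend only on the entries with indices
  \<open>1, \<dots>, m\<close> and \<open>1, \<dots>, n\<close>. Equality of polynomials is
  equality of these functions, as the reals are infinite.
\<close>

definition bilinear_form ::
    "nat \<Rightarrow> nat \<Rightarrow> (nat \<Rightarrow> nat \<Rightarrow> real) \<Rightarrow> (nat \<Rightarrow> real) \<Rightarrow> (nat \<Rightarrow> real) \<Rightarrow> real" where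
  "bilinear_form m n A x y = (\<Sum>i=1..m. \<Sum>j=1..n. A i j * x i * y j)"

definition sum_of_squares_rep ::
    "nat \<Rightarrow> nat \<Rightarrow> ((nat \<Rightarrow> real) \<Rightarrow> (nat \<Rightarrow> real) \<Rightarrow> real) \<Rightarrow> nat \<Rightarrow> bool" where
  "sum_of_squares_rep m n P r \<longleftrightarrow>
     (\<exists>A :: nat \<Rightarrow> nat \<Rightarrow> nat \<Rightarrow> real.
        \<forall>x y. P x y = (\<Sum>s<r. (bilinear_form m n (A s) x y)\<^sup>2))"

text \<open>
  The value is unspecified if \<open>P\<close> is not a finite sum of squares of bilinear forms. Lemma
  \<open>sum_of_squares_rep_assoc_form\<close> below shows that this never happens for the forms
  associated with augmented bipartite graphs.
\<close>

definition SOS_rank ::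
    "nat \<Rightarrow> nat \<Rightarrow> ((nat \<Rightarrow> real) \<Rightarrow> (nat \<Rightarrow> real) \<Rightarrow> real) \<Rightarrow> nat" where
  "SOS_rank m n P = (LEAST r. sum_of_squares_rep m n P r)"

section \<open>Zarankiewicz numbers\<close>

text \<open>
  A bipartite graph on \<open>S = [m]\<close> and \<open>T = [n]\<close> is given by its edge set \<open>E \<subseteq> cells m n\<close>;
  a \<open>C\<^sub>4\<close> in it consists of two rows, two columns and all four cells they determine.
\<close>

definition C4_free :: "cell set \<Rightarrow> bool" where
  "C4_free E \<longleftrightarrow>
     \<not> (\<exists>i j k l. i \<noteq> k \<and> j \<noteq> l \<and> (i, j) \<in> E \<and> (i, l) \<in> E \<and> (k, j) \<in> E \<and> (k, l) \<in> E)"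

definition zarankiewicz :: "nat \<Rightarrow> nat \<Rightarrow> nat" where
  "zarankiewicz m n = Max (card ` {E. E \<subseteq> cells m n \<and> C4_free E})"

section \<open>Augmented bipartite graphs\<close>

text \<open>
  A 2-edge, being an unordered pair of distinct cells, is the two-element set of its halves.
\<close>

type_synonym two_edge = "cell set"

record aug_graph =
  nrows :: nat
  ncols :: nat
  one_edges :: "cell set"
  two_edges :: "two_edge set"

definition augmented_bipartite :: "aug_graph \<Rightarrow> bool" where
  "augmented_bipartite G \<longleftrightarrow>
     one_edges G \<subseteq> cells (nrows G) (ncols G) \<and>
     (\<forall>e \<in> two_edges G. e \<subseteq> cells (nrows G) (ncols G) \<and> card e = 2)"

definition limited :: "aug_graph \<Rightarrow> bool" where
  "limited G \<longleftrightarrow> card (one_edges G) = zarankiewicz (nrows G) (ncols G)"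

definition assoc_form :: "aug_graph \<Rightarrow> (nat \<Rightarrow> real) \<Rightarrow> (nat \<Rightarrow> real) \<Rightarrow> real" where
  "assoc_form G x y =
     (\<Sum>(i, j) \<in> one_edges G. (x i)\<^sup>2 * (y j)\<^sup>2) +
     (\<Sum>e \<in> two_edges G. (\<Sum>(i, j) \<in> e. x i * y j)\<^sup>2)"

definition SOS :: "aug_graph \<Rightarrow> nat" where
  "SOS G = SOS_rank (nrows G) (ncols G) (assoc_form G)"

definition irreducible_form :: "aug_graph \<Rightarrow> bool" where
  "irreducible_form G \<longleftrightarrow> SOS G = card (one_edges G) + card (two_edges G)"

definition occupied :: "aug_graph \<Rightarrow> cell \<Rightarrow> bool" where
  "occupied G c \<longleftrightarrow> c \<in> one_edges G \<or> (\<exists>e \<in> two_edges G. c \<in> e)"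

definition nondegenerate :: "two_edge \<Rightarrow> bool" where
  "nondegenerate e \<longleftrightarrow> (\<exists>i j k l. e = {(i, j), (k, l)} \<and> i \<noteq> k \<and> j \<noteq> l)"

text \<open>
  As \<open>{(i, j), (k, l)} = {(k, l), (i, j)}\<close>, the set below contains both \<open>(i, l)\<close> and \<open>(k, j)\<close>.
\<close>

definition opposite_cells :: "two_edge \<Rightarrow> cell set" where
  "opposite_cells e = {(i, l) | i j k l. e = {(i, j), (k, l)} \<and> i \<noteq> k \<and> j \<noteq> l}"

definition complementary :: "two_edge \<Rightarrow> two_edge \<Rightarrow> bool" where
  "complementary e f \<longleftrightarrow>
     (\<exists>i j k l. i \<noteq> k \<and> j \<noteq> l \<and> e = {(i, j), (k, l)} \<and> f = {(i, l), (k, j)})"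

definition dependency_graph :: "aug_graph \<Rightarrow> (two_edge, two_edge \<times> two_edge) pre_digraph" where
  "dependency_graph G =
     (let V = {e \<in> two_edges G. nondegenerate e} in
      \<lparr> verts = V,
        arcs = {(e, f) \<in> V \<times> V. e \<noteq> f \<and> (\<forall>c \<in> opposite_cells e. occupied G c) \<and>
                  f \<inter> opposite_cells e \<noteq> {}},
        tail = fst,
        head = snd \<rparr>)"

text \<open>
  For the conditions on pairs of edges, an edge is represented by its set of cells: \<open>{c}\<close> for a
  1-edge \<open>c\<close>, and the two halves for a 2-edge.
\<close>

definition edges :: "aug_graph \<Rightarrow> cell set set" where
  "edges G = (\<lambda>c. {c}) ` one_edges G \<union> two_edges G"

definition row_set :: "cell set \<Rightarrow> nat set" where
  "row_set e = fst ` e"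

definition column_set :: "cell set \<Rightarrow> nat set" where
  "column_set e = snd ` e"

definition vertex_disjoint :: "cell set \<Rightarrow> cell set \<Rightarrow> bool" where
  "vertex_disjoint e f \<longleftrightarrow>
     row_set e \<inter> row_set f = {} \<and> column_set e \<inter> column_set f = {}"

definition pair_opposite_cells :: "cell set \<Rightarrow> cell set \<Rightarrow> cell set" where
  "pair_opposite_cells e f = row_set e \<times> column_set f \<union> row_set f \<times> column_set e"

section \<open>The conditions\<close>

definition cond_S :: "aug_graph \<Rightarrow> bool" where
  "cond_S G \<longleftrightarrow>
     (\<forall>e \<in> two_edges G. e \<inter> one_edges G = {} \<and> (\<forall>f \<in> two_edges G. f \<noteq> e \<longrightarrow> e \<inter> f = {}))"

definition cond_W1 :: "aug_graph \<Rightarrow> bool" where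
  "cond_W1 G \<longleftrightarrow> C4_free (one_edges G)"

definition cond_W2 :: "aug_graph \<Rightarrow> bool" where
  "cond_W2 G \<longleftrightarrow>
     (\<forall>p. pre_digraph.cycle (dependency_graph G) p \<longrightarrow>
        (\<exists>e f. complementary e f \<and> p = [(e, f), (f, e)]))"

definition cond_W2' :: "aug_graph \<Rightarrow> bool" where
  "cond_W2' G \<longleftrightarrow>
     \<not> (\<exists>e \<in> two_edges G. nondegenerate e \<and> opposite_cells e \<subseteq> one_edges G)"

definition cond_W3 :: "aug_graph \<Rightarrow> bool" where
  "cond_W3 G \<longleftrightarrow>
     (\<forall>e \<in> edges G. \<forall>f \<in> edges G.
        (e \<in> two_edges G \<or> f \<in> two_edges G) \<and> vertex_disjoint e f \<longrightarrow>
        (\<exists>c \<in> pair_opposite_cells e f. \<not> occupied G c))"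

section \<open>Well-definedness of the SOS rank of associated forms\<close>

lemma bilinear_form_indicator:
  assumes "e \<subseteq> cells m n"
  shows "bilinear_form m n (\<lambda>i j. of_bool ((i, j) \<in> e)) x y = (\<Sum>(i, j) \<in> e. x i * y j)"
proof -
  have "bilinear_form m n (\<lambda>i j. of_bool ((i, j) \<in> e)) x y =
      (\<Sum>(i, j) \<in> cells m n. of_bool ((i, j) \<in> e) * x i * y j)"
    by (simp add: bilinear_form_def cells_def sum.cartesian_product)
  also have "\<dots> = (\<Sum>(i, j) \<in> e. x i * y j)"
    using assms by (intro sum.mono_neutral_cong_right) (auto simp: cells_def)
  finally show ?thesis .
qed

lemma sum_of_squares_rep_assoc_form:
  assumes G: "augmented_bipartite G"
  shows "sum_of_squares_rep (nrows G) (ncols G) (assoc_form G)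
           (card (one_edges G) + card (two_edges G))"
proof -
  let ?C = "cells (nrows G) (ncols G)"
  let ?L = "\<lambda>e x y. \<Sum>(i, j) \<in> e. x i * y j :: real"
  have fin: "finite (one_edges G)" "finite (two_edges G)"
    using G finite_subset[of "one_edges G" ?C] finite_subset[of "two_edges G" "Pow ?C"]
    by (auto simp: augmented_bipartite_def cells_def)
  have disj: "(\<lambda>c. {c}) ` one_edges G \<inter> two_edges G = {}"
    using G by (auto simp: augmented_bipartite_def)
  have card: "card (edges G) = card (one_edges G) + card (two_edges G)"
    unfolding edges_def using fin disj by (simp add: card_Un_disjoint card_image)
  have sub: "e \<subseteq> ?C" if "e \<in> edges G" for e
    using that G by (auto simp: augmented_bipartite_def edges_def)
  have form: "assoc_form G x y = (\<Sum>e \<in> edges G. (?L e x y)\<^sup>2)" for x y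
    unfolding edges_def using fin disj
    by (simp add: sum.union_disjoint sum.reindex assoc_form_def case_prod_beta power_mult_distrib)
  have "finite (edges G)" using fin by (simp add: edges_def)
  then obtain h where h: "bij_betw h {..<card (edges G)} (edges G)"
    using ex_bij_betw_nat_finite[of "edges G"] by (auto simp: atLeast0LessThan)
  have "assoc_form G x y =
      (\<Sum>s<card (edges G).
         (bilinear_form (nrows G) (ncols G) (\<lambda>i j. of_bool ((i, j) \<in> h s)) x y)\<^sup>2)" for x y
    unfolding form sum.reindex_bij_betw[OF h, symmetric]
    using bij_betwE[OF h] sub by (intro sum.cong refl) (simp add: bilinear_form_indicator)
  then show ?thesis
    unfolding sum_of_squares_rep_def card[symmetric]
    by (intro exI[of _ "\<lambda>s i j. of_bool ((i, j) \<in> h s)"]) simp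
qed

end

theory Submission
  imports Defs
begin

text \<open>
  Write \<open>z\<^sub>i\<^sub>j = x\<^sub>i y\<^sub>j\<close>. Let \<open>{(1,1), (1,2)}\<close> be a 2-edge and let \<open>(2,3)\<close> as well as its opposite
  cells \<open>(1,3), (2,1), (2,2)\<close> with this 2-edge be 1-edges. As
  \<open>(z\<^sub>1\<^sub>1 + z\<^sub>1\<^sub>2) z\<^sub>2\<^sub>3 = z\<^sub>1\<^sub>3 (z\<^sub>2\<^sub>1 + z\<^sub>2\<^sub>2)\<close>, adding \<open>2c\<close> times the difference of the two sides does
  not change the form. For \<open>c = 1 / \<surd>2\<close> the part \<open>z\<^sub>1\<^sub>3\<^sup>2 + z\<^sub>2\<^sub>1\<^sup>2 + z\<^sub>2\<^sub>2\<^sup>2 - 2c z\<^sub>1\<^sub>3 (z\<^sub>2\<^sub>1 + z\<^sub>2\<^sub>2)\<close> drops to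
  rank 2, while \<open>(z\<^sub>1\<^sub>1 + z\<^sub>1\<^sub>2)\<^sup>2 + z\<^sub>2\<^sub>3\<^sup>2 + 2c (z\<^sub>1\<^sub>1 + z\<^sub>1\<^sub>2) z\<^sub>2\<^sub>3\<close> keeps rank 2: one square is saved.
  Choosing both 2-edges degenerate leaves the dependency graph without vertices.
\<close>

text \<open>Double counting of column pairs: a pair lying in the neighbourhoods of two rows would
  span a \<open>C4\<close>, so the families \<open>B i\<close> of 2-subsets are disjoint.\<close>

lemma C4_free_sum_choose_two_le:
  assumes sub: "E \<subseteq> cells m n" and C4: "C4_free E"
  shows "(\<Sum>i=1..m. card (E `` {i}) choose 2) \<le> n choose 2"
proof -
  define B where "B i = {X. X \<subseteq> E `` {i} \<and> card X = 2}" for i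
  have row: "E `` {i} \<subseteq> {1..n}" for i
    using sub by (auto simp: cells_def)
  then have finrow: "finite (E `` {i})" for i
    using finite_subset by blast
  have fin: "finite (B i)" for i
    using finrow[of i] by (simp add: B_def)
  have disj: "B i \<inter> B k = {}" if "i \<noteq> k" for i k
  proof (rule equals0I)
    fix X assume "X \<in> B i \<inter> B k"
    then obtain j l where "j \<noteq> l" "{j, l} \<subseteq> E `` {i}" "{j, l} \<subseteq> E `` {k}"
      by (auto simp: B_def card_2_iff)
    then have "(i, j) \<in> E" "(i, l) \<in> E" "(k, j) \<in> E" "(k, l) \<in> E"
      by auto
    then show False
      using C4 \<open>i \<noteq> k\<close> \<open>j \<noteq> l\<close> unfolding C4_free_def by metis
  qed
  have "(\<Sum>i=1..m. card (E `` {i}) choose 2) = (\<Sum>i=1..m. card (B i))"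
    using finrow by (simp add: B_def n_subsets)
  also have "\<dots> = card (\<Union>i\<in>{1..m}. B i)"
    using fin disj by (subst card_UN_disjoint) auto
  also have "\<dots> \<le> card {X. X \<subseteq> {1..n} \<and> card X = 2}"
    using row by (intro card_mono) (auto simp: B_def)
  also have "\<dots> = n choose 2"
    by (simp add: n_subsets)
  finally show ?thesis .
qed

text \<open>Linear lower bound for the convex function \<open>d choose 2\<close>, tight at
  \<open>d = 2\<close> and \<open>d = 3\<close>, the row degrees of an extremal graph.\<close>

lemma two_mult_le_choose_two: "2 * d \<le> (d choose 2) + 3"
proof (induction d)
  case (Suc d)
  have "Suc d choose 2 = d + (d choose 2)"
    by (simp add: numeral_2_eq_2)
  \<comment> \<open>From \<open>d\<close> to \<open>Suc d\<close> the left side grows by 2 and the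
    right side by \<open>d\<close>, so the induction hypothesis suffices only for
    \<open>2 \<le> d\<close>.\<close>
  moreover have "d = 0 \<or> d = 1 \<or> 2 \<le> d"
    by linarith
  ultimately show ?case
    using Suc.IH by auto
qed simp

lemma card_C4_free_4_4_le:
  assumes sub: "E \<subseteq> cells 4 4" and C4: "C4_free E"
  shows "card E \<le> 9"
proof -
  have "E = Sigma {1..4} (\<lambda>i. E `` {i})"
    using sub by (auto simp: cells_def)
  moreover have "E `` {i} \<subseteq> {1..4}" for i
    using sub by (auto simp: cells_def)
  ultimately have "card E = (\<Sum>i=1..4. card (E `` {i}))"
    by (metis card_SigmaI finite_atLeastAtMost finite_subset)
  then have "2 * card E = (\<Sum>i=1..4. 2 * card (E `` {i}))"
    by (simp add: sum_distrib_left)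
  also have "\<dots> \<le> (\<Sum>i=1..4. (card (E `` {i}) choose 2) + 3)"
    by (intro sum_mono two_mult_le_choose_two)
  also have "\<dots> \<le> (4 choose 2) + 12"
    using C4_free_sum_choose_two_le[OF sub C4] by (simp add: sum.distrib)
  finally show ?thesis
    by (simp add: numeral_eq_Suc)
qed

text \<open>Rows 1 to 4 of the 1-edges cover the column pairs 34; 12, 13, 23; 14; 24: each of the
  six pairs exactly once, so the counting bound is attained.\<close>

definition G0 :: aug_graph where
  "G0 = \<lparr> nrows = 4, ncols = 4,
     one_edges = {(1,3), (1,4), (2,1), (2,2), (2,3), (3,1), (3,4), (4,2), (4,4)},
     two_edges = {{(1,1), (1,2)}, {(3,2), (3,3)}} \<rparr>"

lemma G0_sel [simp]:
  "nrows G0 = 4" "ncols G0 = 4"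
  "one_edges G0 = {(1,3), (1,4), (2,1), (2,2), (2,3), (3,1), (3,4), (4,2), (4,4)}"
  "two_edges G0 = {{(1,1), (1,2)}, {(3,2), (3,3)}}"
  by (simp_all add: G0_def)

lemma augmented_bipartite_G0: "augmented_bipartite G0"
  by (auto simp: augmented_bipartite_def cells_def)

lemma card_edges_G0: "card (one_edges G0) = 9" "card (two_edges G0) = 2"
  by (simp_all add: doubleton_eq_iff)

lemma C4_free_G0: "C4_free (one_edges G0)"
proof -
  let ?E = "one_edges G0"
  \<comment> \<open>Letting two diagonal corners of a \<open>C4\<close> range over the edges makes
    the check finite.\<close>
  have "\<forall>p\<in>?E. \<forall>q\<in>?E. fst p \<noteq> fst q \<longrightarrow> snd p \<noteq> snd q \<longrightarrow>
      (fst p, snd q) \<notin> ?E \<or> (fst q, snd p) \<notin> ?E"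
    by simp
  then show ?thesis
    unfolding C4_free_def by (metis fst_conv snd_conv)
qed

lemma limited_G0: "limited G0"
proof -
  have "zarankiewicz 4 4 = 9"
    unfolding zarankiewicz_def
  proof (rule Max_eqI)
    show "finite (card ` {E. E \<subseteq> cells 4 4 \<and> C4_free E})"
      by (simp add: cells_def)
    show "k \<le> 9" if "k \<in> card ` {E. E \<subseteq> cells 4 4 \<and> C4_free E}" for k
      using that card_C4_free_4_4_le by auto
    show "9 \<in> card ` {E. E \<subseteq> cells 4 4 \<and> C4_free E}"
      using augmented_bipartite_G0 C4_free_G0 card_edges_G0(1)
      by (intro image_eqI[of _ _ "one_edges G0"]) (auto simp: augmented_bipartite_def)
  qed
  then show ?thesis
    using card_edges_G0(1) by (simp add: limited_def)
qed

lemma cond_S_G0: "cond_S G0"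
  by (simp add: cond_S_def)

lemma not_nondegenerate_G0: "e \<in> two_edges G0 \<Longrightarrow> \<not> nondegenerate e"
  by (auto simp: nondegenerate_def doubleton_eq_iff)

lemma cond_W2_G0: "cond_W2 G0"
proof -
  have "arcs (dependency_graph G0) = {}" "verts (dependency_graph G0) = {}"
    using not_nondegenerate_G0 by (auto simp: dependency_graph_def Let_def)
  then have "\<not> pre_digraph.cycle (dependency_graph G0) p" for p
    by (auto simp: pre_digraph.cycle_def pre_digraph.awalk_def)
  then show ?thesis
    by (simp add: cond_W2_def)
qed

lemma cond_W2'_G0: "cond_W2' G0"
  using not_nondegenerate_G0 by (auto simp: cond_W2'_def)

lemma not_cond_W3_G0: "\<not> cond_W3 G0"
proof
  assume "cond_W3 G0"
  moreover have "{(2,3)} \<in> edges G0" "{(1,1), (1,2)} \<in> edges G0"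
    by (auto simp: edges_def)
  moreover have "vertex_disjoint {(2,3)} {(1,1), (1,2)}"
    by (simp add: vertex_disjoint_def row_set_def column_set_def)
  ultimately have "\<exists>c \<in> pair_opposite_cells {(2,3)} {(1,1), (1,2)}. \<not> occupied G0 c"
    unfolding cond_W3_def by (metis G0_sel(4) insertI1)
  then show False
    by (auto simp: pair_opposite_cells_def row_set_def column_set_def occupied_def)
qed

text \<open>Since \<open>2 * c * c = 1\<close>, the squares of \<open>c * (s + t)\<close> and
  \<open>c * (s - t)\<close> add up to \<open>s\<^sup>2 + t\<^sup>2\<close>, and the two copies of
  \<open>(c * q)\<^sup>2\<close> to \<open>q\<^sup>2\<close>; the mixed terms cancel by the second
  assumption.\<close>

lemma save_one_square:
  fixes p q r s t c :: real
  assumes "c * c = 1 / 2" "p * q = r * (s + t)"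
  shows "(p + c * q)\<^sup>2 + (c * q)\<^sup>2 + (r - c * (s + t))\<^sup>2 + (c * (s - t))\<^sup>2
    = p\<^sup>2 + q\<^sup>2 + r\<^sup>2 + s\<^sup>2 + t\<^sup>2"
proof -
  have "(p + c * q)\<^sup>2 + (c * q)\<^sup>2 + (r - c * (s + t))\<^sup>2 + (c * (s - t))\<^sup>2
    = p\<^sup>2 + r\<^sup>2 + 2 * (c * c) * (q\<^sup>2 + s\<^sup>2 + t\<^sup>2) + 2 * c * (p * q - r * (s + t))"
    by (simp add: power2_eq_square algebra_simps)
  then show ?thesis
    using assms by simp
qed

lemma sum_of_squares_rep_G0: "sum_of_squares_rep 4 4 (assoc_form G0) 10"
proof -
  define c :: real where "c = 1 / sqrt 2"
  have c: "c * c = 1 / 2"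
    by (simp add: c_def)
  define u :: "nat \<Rightarrow> nat \<Rightarrow> nat \<Rightarrow> nat \<Rightarrow> real" where
    "u k l i j = of_bool (i = k \<and> j = l)" for k l i j
  \<comment> \<open>\<open>u k l\<close> is the coefficient matrix of \<open>x k * y l\<close>. The
    first four entries are the squares of \<open>save_one_square\<close>; the others are the
    remaining five 1-edges and the second 2-edge.\<close>
  define As where "As =
    [\<lambda>i j. u 1 1 i j + u 1 2 i j + c * u 2 3 i j,
     \<lambda>i j. c * u 2 3 i j,
     \<lambda>i j. u 1 3 i j - c * (u 2 1 i j + u 2 2 i j),
     \<lambda>i j. c * (u 2 1 i j - u 2 2 i j),
     u 1 4, u 3 1, u 3 4, u 4 2, u 4 4,
     \<lambda>i j. u 3 2 i j + u 3 3 i j]"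
  have I: "{1..4::nat} = {1, 2, 3, 4}"
    by auto
  have bilin: "bilinear_form 4 4 A x y =
      (\<Sum>i\<in>{1, 2, 3, 4}. \<Sum>j\<in>{1, 2, 3, 4}. A i j * x i * y j)" for A x y
    by (simp only: bilinear_form_def I)
  have "assoc_form G0 x y = (\<Sum>s<10. (bilinear_form 4 4 (As ! s) x y)\<^sup>2)" for x y
  proof -
    have list: "(\<Sum>s<10. (bilinear_form 4 4 (As ! s) x y)\<^sup>2)
        = (\<Sum>A\<leftarrow>As. (bilinear_form 4 4 A x y)\<^sup>2)"
    proof -
      have "length As = 10"
        by (simp add: As_def)
      then show ?thesis
        by (simp add: sum_list_sum_nth atLeast0LessThan)
    qed
    have "(\<Sum>A\<leftarrow>As. (bilinear_form 4 4 A x y)\<^sup>2) =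
      (x 1 * y 1 + x 1 * y 2 + c * (x 2 * y 3))\<^sup>2 + (c * (x 2 * y 3))\<^sup>2 +
      (x 1 * y 3 - c * (x 2 * y 1 + x 2 * y 2))\<^sup>2 + (c * (x 2 * y 1 - x 2 * y 2))\<^sup>2 +
      (x 1 * y 4)\<^sup>2 + (x 3 * y 1)\<^sup>2 + (x 3 * y 4)\<^sup>2 + (x 4 * y 2)\<^sup>2 + (x 4 * y 4)\<^sup>2 +
      (x 3 * y 2 + x 3 * y 3)\<^sup>2"
      by (simp add: As_def bilin u_def algebra_simps)
    also have "\<dots> = assoc_form G0 x y"
      \<comment> \<open>Both products in the second assumption equal
        \<open>x 1 * x 2 * y 3 * (y 1 + y 2)\<close>.\<close>
      using save_one_square[of c "x 1 * y 1 + x 1 * y 2" "x 2 * y 3" "x 1 * y 3" "x 2 * y 1" "x 2 * y 2"] c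
      by (simp add: assoc_form_def doubleton_eq_iff power_mult_distrib algebra_simps)
    finally show ?thesis
      using list by simp
  qed
  then show ?thesis
    unfolding sum_of_squares_rep_def by blast
qed

lemma SOS_G0_le: "SOS G0 \<le> 10"
  unfolding SOS_def SOS_rank_def using sum_of_squares_rep_G0 by (auto intro: Least_le)

theorem proposition22:
  shows "(\<exists>G. augmented_bipartite G \<and> nrows G = 4 \<and> ncols G = 4 \<and> limited G \<and>
            cond_S G \<and> cond_W1 G \<and> cond_W2 G \<and> cond_W2' G \<and> \<not> cond_W3 G \<and>
            SOS G \<le> 10 \<and> card (one_edges G) + card (two_edges G) = 11 \<and>
            \<not> irreducible_form G) \<and>
         \<not> (\<forall>G. augmented_bipartite G \<and> cond_S G \<and> cond_W1 G \<and> cond_W2 G \<and> cond_W2' G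
               \<longrightarrow> irreducible_form G)"
proof -
  have W1: "cond_W1 G0"
    using C4_free_G0 by (simp only: cond_W1_def)
  have card: "card (one_edges G0) + card (two_edges G0) = 11"
    by (simp only: card_edges_G0)
  then have "\<not> irreducible_form G0"
    using SOS_G0_le by (simp only: irreducible_form_def)
  then show ?thesis
    using augmented_bipartite_G0 limited_G0 cond_S_G0 W1 cond_W2_G0 cond_W2'_G0
      not_cond_W3_G0 SOS_G0_le card G0_sel(1,2) by blast
qed

end
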